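(* If the $\lambda$-term $M$ is strongly $\beta$-normalising, then there exist a typing context $\Gamma$ and a type $A$ such that $\Gamma\vdash_s M:A$ is derivable in $\Lambda_\cap^s$.
   Context: $\lambda$-terms: $M::=x\mid MM\mid\lambda x.M$ modulo $\alpha$-conversion; $M[x:=N]$ capture-avoiding substitution; $\beta$-reduction is the contextual closure of $(\lambda x.M)N\to M[x:=N]$; strongly normalising means all reduction sequences are finite. Types: $A::=\varphi\mid A\to A\mid A\cap A$. A typing context is a finite set of pairs $x:A$, where a variable may occur with several types; $\Gamma,x:A$ denotes $\Gamma\cup\{x:A\}$; $x\notin\Gamma$ means no $x:B$ lies in $\Gamma$. Rules of $\Lambda_\cap^s$ ($n\ge0$): (Ax) $\Gamma,x:A\vdash_s x:A$; $(\mathsf{Beta})^s$ from $\Gamma\vdash_s M[x:=N]N_1\dots N_n:A$ and $\Gamma\vdash_s N:B$ infer $\Gamma\vdash_s(\lambda x.M)NN_1\dots N_n:A$; $(\mathsf{L}\to)$ from $\Gamma\vdash_s N:A_1$ and $\Gamma,y:A_2\vdash_s yN_1\dots N_n:B$, with $y\notin FV(N_1)\cup\dots\cup FV(N_n)$, $y\notin\Gamma$, infer $\Gamma,x:A_1\to A_2\vdash_s xNN_1\dots N_n:B$; $(\mathsf{R}\to)$ from $\Gamma,x:A\vdash_s M:B$, $x\notin\Gamma$, infer $\Gamma\vdash_s\lambda x.M:A\to B$; $(\mathsf{L}\cap)$ from $\Gamma,x:A_1,x:A_2\vdash_s xN_1\dots N_n:B$ infer $\Gamma,x:A_1\cap A_2\vdash_s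 xN_1\dots N_n:B$; $(\mathsf{R}\cap)$ from $\Gamma\vdash_s M:A$ and $\Gamma\vdash_s M:B$ infer $\Gamma\vdash_s M:A\cap B$. *)

theory Defs
  imports "HOL-Library.FSet"
begin

text \<open>
  Terms modulo \<open>\<alpha>\<close>-conversion are represented by de Bruijn terms; dangling indices play the
  role of the free variable names.
\<close>

datatype trm = Var nat | App trm trm | Lam trm

text \<open>
  \<open>lift t k\<close> increments the indices \<open>\<ge> k\<close>.  \<open>subst t s k\<close> is the capture-avoiding substitution
  of \<open>s\<close> for \<open>k\<close> in \<open>t\<close>, where the binder of \<open>k\<close> disappears, so that the indices above \<open>k\<close> are
  decremented; the contractum \<open>M[x := N]\<close> of \<open>(\<lambda>x. M) N\<close> is \<open>subst M N 0\<close>.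
\<close>

primrec lift :: "trm \<Rightarrow> nat \<Rightarrow> trm" where
  "lift (Var i) k = (if i < k then Var i else Var (Suc i))"
| "lift (App s t) k = App (lift s k) (lift t k)"
| "lift (Lam t) k = Lam (lift t (Suc k))"

primrec subst :: "trm \<Rightarrow> trm \<Rightarrow> nat \<Rightarrow> trm" where
  "subst (Var i) s k = (if k < i then Var (i - 1) else if i = k then s else Var i)"
| "subst (App t u) s k = App (subst t s k) (subst u s k)"
| "subst (Lam t) s k = Lam (subst t (lift s 0) (Suc k))"

primrec FV :: "trm \<Rightarrow> nat set" where
  "FV (Var i) = {i}"
| "FV (App s t) = FV s \<union> FV t"
| "FV (Lam t) = {i. Suc i \<in> FV t}"

abbreviation Apps :: "trm \<Rightarrow> trm list \<Rightarrow> trm" (infixl "\<degree>\<degree>" 150) where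
  "M \<degree>\<degree> Ns \<equiv> foldl App M Ns"

inductive beta :: "trm \<Rightarrow> trm \<Rightarrow> bool" (infix "\<rightarrow>\<^sub>\<beta>" 50) where
  contract: "App (Lam M) N \<rightarrow>\<^sub>\<beta> subst M N 0"
| appL: "M \<rightarrow>\<^sub>\<beta> M' \<Longrightarrow> App M N \<rightarrow>\<^sub>\<beta> App M' N"
| appR: "N \<rightarrow>\<^sub>\<beta> N' \<Longrightarrow> App M N \<rightarrow>\<^sub>\<beta> App M N'"
| lam: "M \<rightarrow>\<^sub>\<beta> M' \<Longrightarrow> Lam M \<rightarrow>\<^sub>\<beta> Lam M'"

definition strongly_normalising :: "trm \<Rightarrow> bool" where
  "strongly_normalising M \<longleftrightarrow> (\<nexists>f :: nat \<Rightarrow> trm. f 0 = M \<and> (\<forall>i. f i \<rightarrow>\<^sub>\<beta> f (Suc i)))"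

datatype ty =
    Atom nat
  | Arrow ty ty (infixr "\<^bold>\<rightarrow>" 200)
  | Cap ty ty (infixl "\<^bold>\<inter>" 210)

type_synonym ctx = "(nat \<times> ty) fset"

definition fresh_ctx :: "nat \<Rightarrow> ctx \<Rightarrow> bool" where
  "fresh_ctx x \<Gamma> \<longleftrightarrow> (\<forall>B. (x, B) |\<notin>| \<Gamma>)"

text \<open>
  The context \<open>\<Gamma>\<close> as seen from below a binder.  The bound variable, index \<open>0\<close>, is fresh for it;
  this is the side condition \<open>x \<notin> \<Gamma>\<close> of rule \<open>R_arrow\<close>.
\<close>

definition lift_ctx :: "ctx \<Rightarrow> ctx" where
  "lift_ctx \<Gamma> = (\<lambda>(x, B). (Suc x, B)) |`| \<Gamma>"

inductive typing_s :: "ctx \<Rightarrow> trm \<Rightarrow> ty \<Rightarrow> bool" ("_ \<turnstile>\<^sub>s _ : _" [51, 51, 51] 50) where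
  Ax: "finsert (x, A) \<Gamma> \<turnstile>\<^sub>s Var x : A"
| Beta: "\<Gamma> \<turnstile>\<^sub>s subst M N 0 \<degree>\<degree> Ns : A \<Longrightarrow> \<Gamma> \<turnstile>\<^sub>s N : B \<Longrightarrow>
    \<Gamma> \<turnstile>\<^sub>s App (Lam M) N \<degree>\<degree> Ns : A"
| L_arrow: "\<Gamma> \<turnstile>\<^sub>s N : A1 \<Longrightarrow> finsert (y, A2) \<Gamma> \<turnstile>\<^sub>s Var y \<degree>\<degree> Ns : B \<Longrightarrow>
    y \<notin> (\<Union>P\<in>set Ns. FV P) \<Longrightarrow> fresh_ctx y \<Gamma> \<Longrightarrow>
    finsert (x, A1 \<^bold>\<rightarrow> A2) \<Gamma> \<turnstile>\<^sub>s App (Var x) N \<degree>\<degree> Ns : B"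
| R_arrow: "finsert (0, A) (lift_ctx \<Gamma>) \<turnstile>\<^sub>s M : B \<Longrightarrow> \<Gamma> \<turnstile>\<^sub>s Lam M : A \<^bold>\<rightarrow> B"
| L_cap: "finsert (x, A1) (finsert (x, A2) \<Gamma>) \<turnstile>\<^sub>s Var x \<degree>\<degree> Ns : B \<Longrightarrow>
    finsert (x, A1 \<^bold>\<inter> A2) \<Gamma> \<turnstile>\<^sub>s Var x \<degree>\<degree> Ns : B"
| R_cap: "\<Gamma> \<turnstile>\<^sub>s M : A \<Longrightarrow> \<Gamma> \<turnstile>\<^sub>s M : B \<Longrightarrow> \<Gamma> \<turnstile>\<^sub>s M : A \<^bold>\<inter> B"

end

theory Submission
  imports Defs
begin

text \<open>
  Call \<open>A\<close> a component of \<open>C\<close> if \<open>C\<close> is an iterated intersection one of whose members is \<open>A\<close>.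
  Typability is preserved when variables are renamed and each declaration is replaced by one
  whose type has the old type as a component.  This contains weakening, and it makes \<open>L_cap\<close>
  admissible for arbitrary subjects, so that the several types that a context gives to a variable
  can be merged into one before that variable is abstracted.

  Since a reduct of a subterm of \<open>M\<close> is a subterm of a reduct of \<open>M\<close>, a strongly normalising term
  can be typed by induction on its reducts and subterms together.  An abstraction and
  \<open>x N\<^sub>1 \<dots> N\<^sub>n\<close> are typed from their immediate subterms; a head redex
  \<open>(\<lambda>x. M) N N\<^sub>1 \<dots> N\<^sub>n\<close> is typed by \<open>Beta\<close> from its head reduct and \<open>N\<close>.
\<close>

section \<open>Renaming\<close>

definition up :: "(nat \<Rightarrow> nat) \<Rightarrow> nat \<Rightarrow> nat" where
  "up \<rho> i = (case i of 0 \<Rightarrow> 0 | Suc j \<Rightarrow> Suc (\<rho> j))"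

primrec rename :: "(nat \<Rightarrow> nat) \<Rightarrow> trm \<Rightarrow> trm" where
  "rename \<rho> (Var i) = Var (\<rho> i)"
| "rename \<rho> (App s t) = App (rename \<rho> s) (rename \<rho> t)"
| "rename \<rho> (Lam t) = Lam (rename (up \<rho>) t)"

lemma up_simps [simp]: "up \<rho> 0 = 0" "up \<rho> (Suc i) = Suc (\<rho> i)"
  by (simp_all add: up_def)

lemma up_id: "up (\<lambda>i. i) = (\<lambda>i. i)"
  by (rule ext) (simp add: up_def split: nat.split)

lemma up_comp: "up \<rho> \<circ> up \<sigma> = up (\<rho> \<circ> \<sigma>)"
  by (rule ext) (simp add: up_def split: nat.split)

lemma funpow_up_apply: "(up ^^ k) \<rho> i = (if i < k then i else \<rho> (i - k) + k)"
  by (induction k arbitrary: i) (auto simp: up_def split: nat.split)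

lemma rename_id: "rename (\<lambda>i. i) t = t"
  by (induction t) (simp_all add: up_id)

lemma rename_rename: "rename \<rho> (rename \<sigma> t) = rename (\<rho> \<circ> \<sigma>) t"
  by (induction t arbitrary: \<rho> \<sigma>) (simp_all add: up_comp)

lemma rename_cong: "(\<And>i. i \<in> FV t \<Longrightarrow> \<rho> i = \<sigma> i) \<Longrightarrow> rename \<rho> t = rename \<sigma> t"
proof (induction t arbitrary: \<rho> \<sigma>)
  case (Var i)
  then show ?case by simp
next
  case (App s t)
  have "rename \<rho> s = rename \<sigma> s"
    by (rule App.IH) (simp add: App.prems)
  moreover have "rename \<rho> t = rename \<sigma> t"
    by (rule App.IH) (simp add: App.prems)
  ultimately show ?case by simp
next
  case (Lam t)
  have "up \<rho> i = up \<sigma> i" if "i \<in> FV t" for i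
    using Lam.prems that by (cases i) auto
  then have "rename (up \<rho>) t = rename (up \<sigma>) t" by (rule Lam.IH)
  then show ?case by simp
qed

lemma rename_fun_upd_other: "y \<notin> FV t \<Longrightarrow> rename (\<rho>(y := z)) t = rename \<rho> t"
  by (rule rename_cong) auto

lemma rename_Apps [simp]: "rename \<rho> (M \<degree>\<degree> Ns) = rename \<rho> M \<degree>\<degree> map (rename \<rho>) Ns"
  by (induction Ns arbitrary: M) simp_all

lemma lift_eq_rename: "lift t k = rename ((up ^^ k) Suc) t"
proof (induction t arbitrary: k)
  case (Lam t)
  from Lam [of "Suc k"] show ?case by simp
qed (simp_all add: funpow_up_apply)

lemma rename_up_lift: "rename (up \<rho>) (lift t 0) = lift (rename \<rho> t) 0"
  by (simp add: lift_eq_rename rename_rename comp_def)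

lemma rename_subst:
  "rename ((up ^^ k) \<rho>) (subst M N k) =
    subst (rename ((up ^^ Suc k) \<rho>) M) (rename ((up ^^ k) \<rho>) N) k"
proof (induction M arbitrary: N k)
  case (Var i)
  show ?case by (auto simp: funpow_up_apply simp del: funpow.simps)
next
  case (App M1 M2)
  then show ?case by simp
next
  case (Lam M)
  from Lam [of "Suc k" "lift N 0"] show ?case by (simp add: rename_up_lift)
qed

lemma rename_subst_0: "rename \<rho> (subst M N 0) = subst (rename (up \<rho>) M) (rename \<rho> N) 0"
  using rename_subst [of 0] by simp

lemma finite_FV: "finite (FV t)"
proof (induction t)
  case (Lam t)
  then have "finite (Suc -` FV t)" by (rule finite_vimageI) simp
  then show ?case by (simp add: vimage_def)
qed simp_all

section \<open>Weakening up to intersection components\<close>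

lemma ex_fresh_ctx:
  assumes "finite X"
  shows "\<exists>y. y \<notin> X \<and> fresh_ctx y \<Gamma>"
proof -
  have "finite (X \<union> fst ` fset \<Gamma>)" using assms by simp
  then obtain y where "y \<notin> X \<union> fst ` fset \<Gamma>"
    using ex_new_if_finite infinite_UNIV_nat by blast
  then show ?thesis unfolding fresh_ctx_def by force
qed

lemma Ax_fmember: "(x, A) |\<in>| \<Gamma> \<Longrightarrow> \<Gamma> \<turnstile>\<^sub>s Var x : A"
  using Ax [of x A \<Gamma>] by (simp add: finsert_absorb)

lemma L_cap_fmember:
  assumes "(x, A1 \<^bold>\<inter> A2) |\<in>| \<Gamma>"
    and "finsert (x, A1) (finsert (x, A2) \<Gamma>) \<turnstile>\<^sub>s Var x \<degree>\<degree> Ns : B"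
  shows "\<Gamma> \<turnstile>\<^sub>s Var x \<degree>\<degree> Ns : B"
  using L_cap [OF assms(2)] assms(1) by (simp add: finsert_absorb)

lemma L_arrow_fmember:
  assumes "(x, A1 \<^bold>\<rightarrow> A2) |\<in>| \<Gamma>" and "\<Gamma> \<turnstile>\<^sub>s N : A1"
    and "\<And>y. finsert (y, A2) \<Gamma> \<turnstile>\<^sub>s Var y \<degree>\<degree> Ns : B"
  shows "\<Gamma> \<turnstile>\<^sub>s Var x \<degree>\<degree> (N # Ns) : B"
proof -
  have "finite (\<Union>P\<in>set Ns. FV P)" by (simp add: finite_FV)
  then obtain y where "y \<notin> (\<Union>P\<in>set Ns. FV P)" "fresh_ctx y \<Gamma>"
    using ex_fresh_ctx by blast
  from L_arrow [OF assms(2,3) this, of x] assms(1) show ?thesis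
    by (simp add: finsert_absorb)
qed

inductive component :: "ty \<Rightarrow> ty \<Rightarrow> bool" (infix "\<preceq>" 50) where
  refl: "A \<preceq> A"
| left: "A \<preceq> C \<Longrightarrow> A \<preceq> C \<^bold>\<inter> D"
| right: "A \<preceq> D \<Longrightarrow> A \<preceq> C \<^bold>\<inter> D"

lemma component_CapD: "A \<^bold>\<inter> B \<preceq> C \<Longrightarrow> A \<preceq> C \<and> B \<preceq> C"
  by (induction "A \<^bold>\<inter> B" C rule: component.induct) (auto intro: component.intros)

lemma ex_component_upper_bound: "finite S \<Longrightarrow> \<exists>C. \<forall>A\<in>S. A \<preceq> C"
proof (induction S rule: finite_induct)
  case (insert A S)
  then obtain C where "\<forall>B\<in>S. B \<preceq> C" by blast
  then have "\<forall>B\<in>insert A S. B \<preceq> A \<^bold>\<inter> C" by (auto intro: component.intros)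
  then show ?case by blast
qed simp

lemma L_cap_component:
  assumes "A \<preceq> C" and "(x, C) |\<in>| \<Delta>"
    and "\<And>\<Delta>'. \<Delta> |\<subseteq>| \<Delta>' \<Longrightarrow> (x, A) |\<in>| \<Delta>' \<Longrightarrow> \<Delta>' \<turnstile>\<^sub>s Var x \<degree>\<degree> Ns : B"
  shows "\<Delta> \<turnstile>\<^sub>s Var x \<degree>\<degree> Ns : B"
  using assms
proof (induction arbitrary: \<Delta> rule: component.induct)
  case (refl A)
  then show ?case by blast
next
  case (left A C D)
  have "finsert (x, C) (finsert (x, D) \<Delta>) \<turnstile>\<^sub>s Var x \<degree>\<degree> Ns : B"
    by (rule left.IH) (use left.prems(2) in auto)
  with left.prems(1) show ?case by (rule L_cap_fmember)
next
  case (right A D C)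
  have "finsert (x, C) (finsert (x, D) \<Delta>) \<turnstile>\<^sub>s Var x \<degree>\<degree> Ns : B"
    by (rule right.IH) (use right.prems(2) in auto)
  with right.prems(1) show ?case by (rule L_cap_fmember)
qed

lemma L_arrow_component:
  assumes "A1 \<^bold>\<rightarrow> A2 \<preceq> C" and "(x, C) |\<in>| \<Delta>"
    and N: "\<And>\<Delta>'. \<Delta> |\<subseteq>| \<Delta>' \<Longrightarrow> \<Delta>' \<turnstile>\<^sub>s N : A1"
    and Ns: "\<And>\<Delta>' y. \<Delta> |\<subseteq>| \<Delta>' \<Longrightarrow> finsert (y, A2) \<Delta>' \<turnstile>\<^sub>s Var y \<degree>\<degree> Ns : B"
  shows "\<Delta> \<turnstile>\<^sub>s Var x \<degree>\<degree> (N # Ns) : B"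
  using assms(1,2)
proof (rule L_cap_component)
  fix \<Delta>' assume "\<Delta> |\<subseteq>| \<Delta>'" and "(x, A1 \<^bold>\<rightarrow> A2) |\<in>| \<Delta>'"
  from this(2) N [OF this(1)] Ns [OF this(1)]
  show "\<Delta>' \<turnstile>\<^sub>s Var x \<degree>\<degree> (N # Ns) : B" by (rule L_arrow_fmember)
qed

definition covers :: "(nat \<Rightarrow> nat) \<Rightarrow> ctx \<Rightarrow> ctx \<Rightarrow> bool" where
  "covers \<rho> \<Gamma> \<Delta> \<longleftrightarrow> (\<forall>x A. (x, A) |\<in>| \<Gamma> \<longrightarrow> (\<exists>C. (\<rho> x, C) |\<in>| \<Delta> \<and> A \<preceq> C))"

lemma covers_finsert:
  "covers \<rho> (finsert (x, A) \<Gamma>) \<Delta> \<longleftrightarrow> (\<exists>C. (\<rho> x, C) |\<in>| \<Delta> \<and> A \<preceq> C) \<and> covers \<rho> \<Gamma> \<Delta>"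
  unfolding covers_def by auto

lemma covers_mono: "covers \<rho> \<Gamma> \<Delta> \<Longrightarrow> \<Delta> |\<subseteq>| \<Delta>' \<Longrightarrow> covers \<rho> \<Gamma> \<Delta>'"
  unfolding covers_def by blast

lemma covers_id_fsubset: "\<Gamma> |\<subseteq>| \<Delta> \<Longrightarrow> covers (\<lambda>x. x) \<Gamma> \<Delta>"
  unfolding covers_def by (auto intro: component.refl)

lemma covers_finsert_fun_upd:
  "fresh_ctx y \<Gamma> \<Longrightarrow> covers \<rho> \<Gamma> \<Delta> \<Longrightarrow> covers (\<rho>(y := z)) (finsert (y, A) \<Gamma>) (finsert (z, A) \<Delta>)"
  unfolding covers_def fresh_ctx_def by (fastforce intro: component.refl)

lemma fmember_lift_ctx_iff: "(x, A) |\<in>| lift_ctx \<Gamma> \<longleftrightarrow> (\<exists>y. x = Suc y \<and> (y, A) |\<in>| \<Gamma>)"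
  unfolding lift_ctx_def by force

lemma covers_finsert_lift_ctx:
  "covers \<rho> \<Gamma> \<Delta> \<Longrightarrow> covers (up \<rho>) (finsert (0, A) (lift_ctx \<Gamma>)) (finsert (0, A) (lift_ctx \<Delta>))"
  unfolding covers_def by (auto simp: fmember_lift_ctx_iff intro: component.refl)

lemma typing_s_rename: "\<Gamma> \<turnstile>\<^sub>s M : A \<Longrightarrow> covers \<rho> \<Gamma> \<Delta> \<Longrightarrow> \<Delta> \<turnstile>\<^sub>s rename \<rho> M : A"
proof (induction arbitrary: \<rho> \<Delta> rule: typing_s.induct)
  case (Ax x A \<Gamma>)
  then obtain C where "A \<preceq> C" "(\<rho> x, C) |\<in>| \<Delta>" by (auto simp: covers_finsert)
  then have "\<Delta> \<turnstile>\<^sub>s Var (\<rho> x) \<degree>\<degree> [] : A"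
    by (rule L_cap_component) (simp add: Ax_fmember)
  then show ?case by simp
next
  case (Beta \<Gamma> M N Ns A B)
  have "\<Delta> \<turnstile>\<^sub>s subst (rename (up \<rho>) M) (rename \<rho> N) 0 \<degree>\<degree> map (rename \<rho>) Ns : A"
    using Beta.IH(1) [OF Beta.prems] by (simp add: rename_subst_0)
  from typing_s.Beta [OF this Beta.IH(2) [OF Beta.prems]] show ?case by simp
next
  case (L_arrow \<Gamma> N A1 y A2 Ns B x)
  then obtain C where "A1 \<^bold>\<rightarrow> A2 \<preceq> C" "(\<rho> x, C) |\<in>| \<Delta>" and "covers \<rho> \<Gamma> \<Delta>"
    by (auto simp: covers_finsert)
  from this(1,2) have "\<Delta> \<turnstile>\<^sub>s Var (\<rho> x) \<degree>\<degree> (rename \<rho> N # map (rename \<rho>) Ns) : B"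
  proof (rule L_arrow_component)
    fix \<Delta>' z assume "\<Delta> |\<subseteq>| \<Delta>'"
    with \<open>covers \<rho> \<Gamma> \<Delta>\<close> have cov: "covers \<rho> \<Gamma> \<Delta>'" by (rule covers_mono)
    then show "\<Delta>' \<turnstile>\<^sub>s rename \<rho> N : A1" by (rule L_arrow.IH)
    have "map (rename (\<rho>(y := z))) Ns = map (rename \<rho>) Ns"
      using L_arrow.hyps(3) by (simp add: rename_fun_upd_other)
    with L_arrow.IH(2) [OF covers_finsert_fun_upd [OF L_arrow.hyps(4) cov, of z]]
    show "finsert (z, A2) \<Delta>' \<turnstile>\<^sub>s Var z \<degree>\<degree> map (rename \<rho>) Ns : B"
      by (simp only: rename_Apps rename.simps fun_upd_same)
  qed
  then show ?case by simp
next
  case (R_arrow A \<Gamma> M B)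
  from R_arrow.IH [OF covers_finsert_lift_ctx [OF R_arrow.prems]]
  show ?case by (simp add: typing_s.R_arrow)
next
  case (L_cap x A1 A2 \<Gamma> Ns B)
  then have "covers \<rho> (finsert (x, A1) (finsert (x, A2) \<Gamma>)) \<Delta>"
    by (auto simp: covers_finsert dest: component_CapD)
  then show ?case by (rule L_cap.IH)
next
  case (R_cap \<Gamma> M A B)
  then show ?case by (simp add: typing_s.R_cap)
qed

lemma typing_s_covers: "\<Gamma> \<turnstile>\<^sub>s M : A \<Longrightarrow> covers (\<lambda>x. x) \<Gamma> \<Delta> \<Longrightarrow> \<Delta> \<turnstile>\<^sub>s M : A"
  using typing_s_rename [of \<Gamma> M A "\<lambda>x. x" \<Delta>] by (simp add: rename_id)

lemma typing_s_weaken: "\<Gamma> \<turnstile>\<^sub>s M : A \<Longrightarrow> \<Gamma> |\<subseteq>| \<Delta> \<Longrightarrow> \<Delta> \<turnstile>\<^sub>s M : A"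
  using typing_s_covers covers_id_fsubset by blast

section \<open>Typable terms\<close>

definition typable :: "trm \<Rightarrow> bool" where
  "typable M \<longleftrightarrow> (\<exists>\<Gamma> A. \<Gamma> \<turnstile>\<^sub>s M : A)"

lemma typable_common_ctx:
  "finite T \<Longrightarrow> \<forall>M\<in>T. typable M \<Longrightarrow> \<exists>\<Gamma>. \<forall>M\<in>T. \<exists>A. \<Gamma> \<turnstile>\<^sub>s M : A"
proof (induction T rule: finite_induct)
  case (insert M T)
  then obtain \<Gamma> \<Delta> A where "\<forall>N\<in>T. \<exists>B. \<Gamma> \<turnstile>\<^sub>s N : B" and "\<Delta> \<turnstile>\<^sub>s M : A"
    unfolding typable_def by auto
  moreover have "\<Gamma> |\<union>| \<Delta> \<turnstile>\<^sub>s N : B" if "\<Gamma> \<turnstile>\<^sub>s N : B \<or> \<Delta> \<turnstile>\<^sub>s N : B" for N B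
    using that typing_s_weaken by blast
  ultimately have "\<forall>N\<in>insert M T. \<exists>B. \<Gamma> |\<union>| \<Delta> \<turnstile>\<^sub>s N : B" by blast
  then show ?case by blast
qed simp

lemma ex_covers_lift_ctx: "\<exists>C \<Delta>. covers (\<lambda>x. x) \<Gamma> (finsert (0, C) (lift_ctx \<Delta>))"
proof -
  have "finite (snd ` fset \<Gamma>)" by simp
  then obtain C where C: "\<forall>A\<in>snd ` fset \<Gamma>. A \<preceq> C" using ex_component_upper_bound by blast
  \<comment> \<open>\<open>0 - 1 = 0\<close>: the declarations of \<open>0\<close> leave harmless extra entries in \<open>\<Delta>\<close>.\<close>
  define \<Delta> where "\<Delta> = (\<lambda>(x, A). (x - 1, A)) |`| \<Gamma>"
  have "\<exists>D. (x, D) |\<in>| finsert (0, C) (lift_ctx \<Delta>) \<and> A \<preceq> D" if "(x, A) |\<in>| \<Gamma>" for x A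
  proof (cases x)
    case 0
    with that C show ?thesis by force
  next
    case (Suc y)
    with that have "(y, A) |\<in>| \<Delta>" unfolding \<Delta>_def by force
    with Suc show ?thesis by (auto simp: fmember_lift_ctx_iff intro: component.refl)
  qed
  then show ?thesis unfolding covers_def by auto
qed

lemma typable_Lam:
  assumes "typable M"
  shows "typable (Lam M)"
proof -
  obtain \<Gamma> B where "\<Gamma> \<turnstile>\<^sub>s M : B" using assms unfolding typable_def by blast
  moreover obtain C \<Delta> where "covers (\<lambda>x. x) \<Gamma> (finsert (0, C) (lift_ctx \<Delta>))"
    using ex_covers_lift_ctx by blast
  ultimately have "finsert (0, C) (lift_ctx \<Delta>) \<turnstile>\<^sub>s M : B" by (rule typing_s_covers)
  then have "\<Delta> \<turnstile>\<^sub>s Lam M : C \<^bold>\<rightarrow> B" by (rule R_arrow)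
  then show ?thesis unfolding typable_def by blast
qed

lemma ex_typing_s_Var_Apps:
  assumes "\<forall>N\<in>set Ns. \<exists>A. \<Gamma> \<turnstile>\<^sub>s N : A"
  shows "\<exists>C. \<forall>x. finsert (x, C) \<Gamma> \<turnstile>\<^sub>s Var x \<degree>\<degree> Ns : B"
  using assms
proof (induction Ns)
  case Nil
  show ?case by (auto intro: Ax)
next
  case (Cons N Ns)
  then obtain C where Ns: "\<forall>y. finsert (y, C) \<Gamma> \<turnstile>\<^sub>s Var y \<degree>\<degree> Ns : B" by auto
  from Cons.prems obtain A where N: "\<Gamma> \<turnstile>\<^sub>s N : A" by auto
  have "finsert (x, A \<^bold>\<rightarrow> C) \<Gamma> \<turnstile>\<^sub>s Var x \<degree>\<degree> (N # Ns) : B" for x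
  proof (rule L_arrow_fmember)
    show "finsert (x, A \<^bold>\<rightarrow> C) \<Gamma> \<turnstile>\<^sub>s N : A"
      using N by (rule typing_s_weaken) auto
    show "finsert (y, C) (finsert (x, A \<^bold>\<rightarrow> C) \<Gamma>) \<turnstile>\<^sub>s Var y \<degree>\<degree> Ns : B" for y
      using Ns [rule_format] by (rule typing_s_weaken) auto
  qed simp
  then show ?case by blast
qed

lemma typable_Var_Apps:
  assumes "\<forall>N\<in>set Ns. typable N"
  shows "typable (Var x \<degree>\<degree> Ns)"
proof -
  obtain \<Gamma> where "\<forall>N\<in>set Ns. \<exists>A. \<Gamma> \<turnstile>\<^sub>s N : A"
    using typable_common_ctx [OF finite_set assms] by blast
  then show ?thesis
    using ex_typing_s_Var_Apps unfolding typable_def by blast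
qed

lemma typable_Redex_Apps:
  assumes "typable (subst M N 0 \<degree>\<degree> Ns)" and "typable N"
  shows "typable (App (Lam M) N \<degree>\<degree> Ns)"
proof -
  obtain \<Gamma> A B where "\<Gamma> \<turnstile>\<^sub>s subst M N 0 \<degree>\<degree> Ns : A" "\<Gamma> \<turnstile>\<^sub>s N : B"
    using typable_common_ctx [of "{subst M N 0 \<degree>\<degree> Ns, N}"] assms by auto
  then have "\<Gamma> \<turnstile>\<^sub>s App (Lam M) N \<degree>\<degree> Ns : A" by (rule Beta)
  then show ?thesis unfolding typable_def by blast
qed

section \<open>Induction on strongly normalising terms\<close>

lemma accp_if_no_infinite_descent:
  assumes "\<nexists>f. f 0 = x \<and> (\<forall>i::nat. R (f (Suc i)) (f i))"
  shows "Wellfounded.accp R x"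
proof (rule ccontr)
  assume "\<not> Wellfounded.accp R x"
  moreover have "\<exists>z. \<not> Wellfounded.accp R z \<and> R z y" if "\<not> Wellfounded.accp R y" for y
    using that by (blast elim: not_accp_down)
  ultimately have "\<exists>f. \<forall>i. (\<not> Wellfounded.accp R (f i) \<and> (i = 0 \<longrightarrow> f i = x)) \<and> R (f (Suc i)) (f i)"
    by (intro dependent_nat_choice) auto
  with assms show False by blast
qed

lemma relcompp_tranclp_commute:
  assumes "R OO S \<le> S OO R"
  shows "R OO S\<^sup>+\<^sup>+ \<le> S\<^sup>+\<^sup>+ OO R"
proof (rule predicate2I, erule relcomppE)
  have commute: "\<exists>w. S x w \<and> R w z" if "R x y" and "S y z" for x y z
    using predicate2D [OF assms] that by blast
  fix x y z
  assume "R x y" and "S\<^sup>+\<^sup>+ y z"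
  from this(2,1) show "(S\<^sup>+\<^sup>+ OO R) x z"
  proof (induction rule: tranclp_induct)
    case (base z)
    with commute show ?case by blast
  next
    case (step z z')
    then obtain w where "S\<^sup>+\<^sup>+ x w" and "R w z" by blast
    moreover from \<open>R w z\<close> \<open>S z z'\<close> obtain w' where "S w w'" and "R w' z'"
      using commute by blast
    ultimately show ?case by (meson relcomppI tranclp.trancl_into_trancl)
  qed
qed

lemma accp_sup_if_commute:
  assumes "wfp S" and "transp S" and "R OO S \<le> S OO R" and "Wellfounded.accp R x"
  shows "Wellfounded.accp (sup R S) x"
proof -
  have "Wellfounded.accp (sup R S) y" if "S\<^sup>=\<^sup>= y x" for y
    using assms(4) that
  proof (induction arbitrary: y rule: accp.induct)
    case (accI x)
    from \<open>wfp S\<close> \<open>S\<^sup>=\<^sup>= y x\<close> show ?case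
    proof (induction y rule: wfp_induct_rule)
      case (less y)
      show ?case
      proof (rule accp.accI)
        fix z assume "sup R S z y"
        then consider (R) "R z y" | (S) "S z y" by auto
        then show "Wellfounded.accp (sup R S) z"
        proof cases
          case R
          with less.prems obtain w where "S\<^sup>=\<^sup>= z w" and "R w x"
            using predicate2D [OF assms(3)] by blast
          then show ?thesis by (rule accI.IH [rotated])
        next
          case S
          with less.prems \<open>transp S\<close> have "S\<^sup>=\<^sup>= z x" by (auto dest: transpD)
          with S show ?thesis by (rule less.IH)
        qed
      qed
    qed
  qed
  then show ?thesis by simp
qed

inductive immediate_subterm :: "trm \<Rightarrow> trm \<Rightarrow> bool" where
  appL: "immediate_subterm M (App M N)"
| appR: "immediate_subterm N (App M N)"
| lam: "immediate_subterm M (Lam M)"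

lemma wfp_immediate_subterm: "wfp immediate_subterm"
  by (rule wfp_if_convertible_to_nat [of _ size]) (auto elim: immediate_subterm.cases)

lemma beta_immediate_subterm_commute:
  "(\<rightarrow>\<^sub>\<beta>)\<inverse>\<inverse> OO immediate_subterm \<le> immediate_subterm OO (\<rightarrow>\<^sub>\<beta>)\<inverse>\<inverse>"
proof -
  have "\<exists>M'. M \<rightarrow>\<^sub>\<beta> M' \<and> immediate_subterm N' M'"
    if "immediate_subterm N M" and "N \<rightarrow>\<^sub>\<beta> N'" for N N' M
    using that by cases (blast intro: beta.appL beta.appR beta.lam immediate_subterm.intros)+
  then show ?thesis by blast
qed

lemma immediate_subterm_tranclp_Apps: "N \<in> set Ns \<Longrightarrow> immediate_subterm\<^sup>+\<^sup>+ N (M \<degree>\<degree> Ns)"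
proof (induction Ns rule: rev_induct)
  case (snoc P Ns)
  then consider (last) "N = P" | (init) "immediate_subterm\<^sup>+\<^sup>+ N (M \<degree>\<degree> Ns)" by auto
  then show ?case
  proof cases
    case last
    then show ?thesis by (simp add: immediate_subterm.appR tranclp.r_into_trancl)
  next
    case init
    then have "immediate_subterm\<^sup>+\<^sup>+ N (App (M \<degree>\<degree> Ns) P)"
      using immediate_subterm.appL by (rule tranclp.trancl_into_trancl)
    then show ?thesis by simp
  qed
qed simp

lemma beta_Apps: "M \<rightarrow>\<^sub>\<beta> M' \<Longrightarrow> M \<degree>\<degree> Ns \<rightarrow>\<^sub>\<beta> M' \<degree>\<degree> Ns"
  by (induction Ns arbitrary: M M') (auto intro: beta.appL)

lemma trm_head_cases:
  obtains (Lam) M' where "M = Lam M'"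
    | (Var_Apps) x Ns where "M = Var x \<degree>\<degree> Ns"
    | (Redex_Apps) P N Ns where "M = App (Lam P) N \<degree>\<degree> Ns"
proof (induction M arbitrary: thesis)
  case (Var x)
  show ?case by (rule Var(2) [of x "[]"]) simp
next
  case (App M N)
  show ?case
  proof (rule App.IH(1))
    show thesis if "M = Lam M'" for M'
      using that by (intro App.prems(3) [of M' N "[]"]) simp
    show thesis if "M = Var x \<degree>\<degree> Ns" for x Ns
      using that by (intro App.prems(2) [of x "Ns @ [N]"]) simp
    show thesis if "M = App (Lam P) Q \<degree>\<degree> Ns" for P Q Ns
      using that by (intro App.prems(3) [of P Q "Ns @ [N]"]) simp
  qed
next
  case (Lam M)
  show ?case by (rule Lam.prems(1)) simp
qed

lemma strongly_normalising_accp: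
  assumes "strongly_normalising M"
  shows "Wellfounded.accp (sup (\<rightarrow>\<^sub>\<beta>)\<inverse>\<inverse> immediate_subterm\<^sup>+\<^sup>+) M"
proof (rule accp_sup_if_commute)
  show "wfp immediate_subterm\<^sup>+\<^sup>+"
    by (rule wfp_tranclp) (rule wfp_immediate_subterm)
  show "transp immediate_subterm\<^sup>+\<^sup>+"
    by (rule transpI) (rule tranclp_trans)
  show "(\<rightarrow>\<^sub>\<beta>)\<inverse>\<inverse> OO immediate_subterm\<^sup>+\<^sup>+ \<le> immediate_subterm\<^sup>+\<^sup>+ OO (\<rightarrow>\<^sub>\<beta>)\<inverse>\<inverse>"
    by (rule relcompp_tranclp_commute) (rule beta_immediate_subterm_commute)
  show "termip (\<rightarrow>\<^sub>\<beta>) M"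
    using assms by (intro accp_if_no_infinite_descent) (simp add: strongly_normalising_def)
qed

lemma strongly_normalising_induct [consumes 1, case_names Lam Var_Apps Redex_Apps]:
  assumes "strongly_normalising M"
    and "\<And>M. P M \<Longrightarrow> P (Lam M)"
    and "\<And>x Ns. \<forall>N\<in>set Ns. P N \<Longrightarrow> P (Var x \<degree>\<degree> Ns)"
    and "\<And>M N Ns. P (subst M N 0 \<degree>\<degree> Ns) \<Longrightarrow> P N \<Longrightarrow> P (App (Lam M) N \<degree>\<degree> Ns)"
  shows "P M"
  using strongly_normalising_accp [OF assms(1)]
proof (induction rule: accp.induct)
  case (accI M)
  have subterm: "P N" if "immediate_subterm\<^sup>+\<^sup>+ N M" for N
    using that by (intro accI.IH) simp
  have reduct: "P N" if "M \<rightarrow>\<^sub>\<beta> N" for N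
    using that by (intro accI.IH) simp
  show ?case
  proof (cases M rule: trm_head_cases)
    case (Lam N)
    then have "P N" by (intro subterm) (auto intro: immediate_subterm.lam)
    with Lam assms(2) show ?thesis by simp
  next
    case (Var_Apps x Ns)
    then have "\<forall>N\<in>set Ns. P N" by (auto intro: subterm immediate_subterm_tranclp_Apps)
    with Var_Apps assms(3) show ?thesis by simp
  next
    case (Redex_Apps Q N Ns)
    have "M \<rightarrow>\<^sub>\<beta> subst Q N 0 \<degree>\<degree> Ns"
      unfolding Redex_Apps by (rule beta_Apps) (rule beta.contract)
    then have "P (subst Q N 0 \<degree>\<degree> Ns)" by (rule reduct)
    moreover have "P N"
      using immediate_subterm_tranclp_Apps [of N "N # Ns" "Lam Q"] Redex_Apps
      by (intro subterm) simp
    ultimately show ?thesis unfolding Redex_Apps by (rule assms(4))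
  qed
qed

theorem theorem4:
  fixes M :: trm
  assumes "strongly_normalising M"
  shows "\<exists>(\<Gamma> :: ctx) (A :: ty). \<Gamma> \<turnstile>\<^sub>s M : A"
proof -
  from assms have "typable M"
  proof (induction rule: strongly_normalising_induct)
    case (Lam M)
    then show ?case by (rule typable_Lam)
  next
    case (Var_Apps x Ns)
    then show ?case by (rule typable_Var_Apps)
  next
    case (Redex_Apps M N Ns)
    then show ?case by (rule typable_Redex_Apps)
  qed
  then show ?thesis unfolding typable_def .
qed

end
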